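(* Let $(X,\mathsf a)$ be an action space. For every $\lambda>0$ the function $\mathsf d_{\mathsf a,\lambda}:X\times X\to[0,+\infty)$, $$\mathsf d_{\mathsf a,\lambda}(u_1,u_2)=\lambda\,\inf\{r>0:\ \mathsf a(r,u_1,u_2)<\lambda r\},$$ is a metric on $X$ which satisfies $$\mathsf d_{\mathsf a,\lambda}(u_1,u_2)\le \max\{\lambda\tau,\mathsf a(\tau,u_1,u_2)\}\le \lambda\tau+\mathsf a(\tau,u_1,u_2)\quad\text{for every }\tau>0,\ u_1,u_2\in X,$$ and, for every $r>0$ and $u_1,u_2\in X$, $$\mathsf d_{\mathsf a,\lambda}(u_1,u_2)<\lambda r\ \Longrightarrow\ \mathsf a(r,u_1,u_2)<\lambda r .$$ In particular $\mathsf d_{\mathsf a,\lambda}$ metrizes the uniform structure $\mathfrak U$ (and a fortiori the topology $\mathfrak O$): setting $\mathrm B_\lambda(r):=\{(u_1,u_2)\in X\times X:\ \mathsf d_{\mathsf a,\lambda}(u_1,u_2)<\lambda r\}$, we have (1) for every $\tau,c>0$, choosing $r\in(0,\min\{\tau,c/\lambda\}]$ we have $\mathrm B_\lambda(r)\subset \mathrm V(\tau,c)$; (2) for every $r>0$, choosing $\tau,c\in(0,r]$ we have $\mathrm V(\tau,c)\subset \mathrm B_\lambda(r)$.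
   Context: An action cost on a set $X$ is a function $\mathsf a:(0,+\infty)\times X\times X\to[0,+\infty)$ such that for all $\tau,\tau_1,\tau_2>0$ and $u_1,u_2,u_3\in X$: (i) $\mathsf a(\tau,u_1,u_2)=0$ if and only if $u_1=u_2$; (ii) $\mathsf a(\tau,u_1,u_2)=\mathsf a(\tau,u_2,u_1)$; (iii) $\mathsf a(\tau_1+\tau_2,u_1,u_3)\le \mathsf a(\tau_1,u_1,u_2)+\mathsf a(\tau_2,u_2,u_3)$. The pair $(X,\mathsf a)$ is called an action space. For $\tau,c>0$ set $\mathrm V(\tau,c):=\{(u_1,u_2)\in X\times X:\ \mathsf a(\tau,u_1,u_2)<c\}$. The uniform structure induced by $\mathsf a$ is $\mathfrak U:=\{\mathrm U\subset X\times X:\ \mathrm U\supset \mathrm V(\tau,c)\text{ for some }\tau,c>0\}$. The topology $\mathfrak O$ induced by $\mathsf a$ is the one for which the neighborhoods of $u\in X$ are exactly the sets containing $\{v\in X:\mathsf a(\tau,u,v)<c\}$ for some $\tau,c>0$.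
   Formalization: Item (2) is false as printed for arbitrary τ, c in (0,r] (it can fail for c > λr, or for τ = r when the action jumps at time r); it is proved instead for every τ in (0,r) and every c in (0,λr]. *)

theory Defs
  imports "HOL-Analysis.Analysis"
begin

text \<open>The first argument of \<open>a\<close> ranges over positive reals only; values at nonpositive times or
  outside \<open>X\<close> are irrelevant.\<close>

locale action_space =
  fixes X :: "'a set" and a :: "real \<Rightarrow> 'a \<Rightarrow> 'a \<Rightarrow> real"
  assumes action_nonneg:
      "\<And>\<tau> u v. \<lbrakk>0 < \<tau>; u \<in> X; v \<in> X\<rbrakk> \<Longrightarrow> 0 \<le> a \<tau> u v"
    and action_eq_0_iff:
      "\<And>\<tau> u v. \<lbrakk>0 < \<tau>; u \<in> X; v \<in> X\<rbrakk> \<Longrightarrow> a \<tau> u v = 0 \<longleftrightarrow> u = v"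
    and action_commute:
      "\<And>\<tau> u v. \<lbrakk>0 < \<tau>; u \<in> X; v \<in> X\<rbrakk> \<Longrightarrow> a \<tau> u v = a \<tau> v u"
    and action_triangle:
      "\<And>\<tau>\<^sub>1 \<tau>\<^sub>2 u v w. \<lbrakk>0 < \<tau>\<^sub>1; 0 < \<tau>\<^sub>2; u \<in> X; v \<in> X; w \<in> X\<rbrakk> \<Longrightarrow>
         a (\<tau>\<^sub>1 + \<tau>\<^sub>2) u w \<le> a \<tau>\<^sub>1 u v + a \<tau>\<^sub>2 v w"

definition action_entourage ::
    "'a set \<Rightarrow> (real \<Rightarrow> 'a \<Rightarrow> 'a \<Rightarrow> real) \<Rightarrow> real \<Rightarrow> real \<Rightarrow> ('a \<times> 'a) set" where
  "action_entourage X a \<tau> c = {(u, v) \<in> X \<times> X. a \<tau> u v < c}"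

definition action_uniformity ::
    "'a set \<Rightarrow> (real \<Rightarrow> 'a \<Rightarrow> 'a \<Rightarrow> real) \<Rightarrow> ('a \<times> 'a) set set" where
  "action_uniformity X a =
     {U. U \<subseteq> X \<times> X \<and> (\<exists>\<tau>>0. \<exists>c>0. action_entourage X a \<tau> c \<subseteq> U)}"

definition metric_uniformity ::
    "'a set \<Rightarrow> ('a \<Rightarrow> 'a \<Rightarrow> real) \<Rightarrow> ('a \<times> 'a) set set" where
  "metric_uniformity X d =
     {U. U \<subseteq> X \<times> X \<and> (\<exists>\<epsilon>>0. {(u, v) \<in> X \<times> X. d u v < \<epsilon>} \<subseteq> U)}"

definition neighborhoods :: "'a topology \<Rightarrow> 'a \<Rightarrow> 'a set set" where
  "neighborhoods T u = {N. N \<subseteq> topspace T \<and> (\<exists>W. openin T W \<and> u \<in> W \<and> W \<subseteq> N)}"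

definition action_neighborhoods ::
    "'a set \<Rightarrow> (real \<Rightarrow> 'a \<Rightarrow> 'a \<Rightarrow> real) \<Rightarrow> 'a \<Rightarrow> 'a set set" where
  "action_neighborhoods X a u =
     {N. N \<subseteq> X \<and> (\<exists>\<tau>>0. \<exists>c>0. {v \<in> X. a \<tau> u v < c} \<subseteq> N)}"

text \<open>Existence and uniqueness of the described topology are shown in
  \<open>action_topology_ex1\<close> below.\<close>

definition action_topology ::
    "'a set \<Rightarrow> (real \<Rightarrow> 'a \<Rightarrow> 'a \<Rightarrow> real) \<Rightarrow> 'a topology" where
  "action_topology X a =
     (THE T. topspace T = X \<and> (\<forall>u\<in>X. neighborhoods T u = action_neighborhoods X a u))"

text \<open>The distance is extended by \<open>0\<close> outside \<open>X \<times> X\<close>: the locale \<^locale>\<open>Metric_space\<close> requires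
  nonnegativity and symmetry for all elements of the type. On \<open>X \<times> X\<close> the set below is nonempty
  and bounded from below, so that \<^const>\<open>Inf\<close> is the genuine infimum.\<close>

definition action_dist ::
    "'a set \<Rightarrow> (real \<Rightarrow> 'a \<Rightarrow> 'a \<Rightarrow> real) \<Rightarrow> real \<Rightarrow> 'a \<Rightarrow> 'a \<Rightarrow> real" where
  "action_dist X a lam u v =
     (if u \<in> X \<and> v \<in> X then lam * Inf {r. 0 < r \<and> a r u v < lam * r} else 0)"

text \<open>The radius is scaled by \<open>lam\<close>. An inclusion of \<open>action_entourage X a \<tau> c\<close> in
  \<open>action_dist_entourage X a lam r\<close> can only be expected for \<open>\<tau> < r\<close> and \<open>c \<le> lam * r\<close>: for \<open>\<tau> = r\<close>
  the distance may be equal to \<open>lam * r\<close> when \<open>a\<close> jumps at time \<open>r\<close>, and if \<open>a\<close> is a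
  time-independent metric then \<open>action_dist X a lam = a\<close> on \<open>X\<close>.\<close>

definition action_dist_entourage ::
    "'a set \<Rightarrow> (real \<Rightarrow> 'a \<Rightarrow> 'a \<Rightarrow> real) \<Rightarrow> real \<Rightarrow> real \<Rightarrow> ('a \<times> 'a) set" where
  "action_dist_entourage X a lam r = {(u, v) \<in> X \<times> X. action_dist X a lam u v < lam * r}"

lemma openin_iff_neighborhoods:
  "openin T W \<longleftrightarrow> W \<subseteq> topspace T \<and> (\<forall>u\<in>W. W \<in> neighborhoods T u)"
  unfolding neighborhoods_def
  by (auto dest: openin_subset) (metis openin_subopen)

context action_space
begin

lemma action_antimono:
  assumes "0 < s" "s \<le> t" "u \<in> X" "v \<in> X"
  shows "a t u v \<le> a s u v"
proof (cases "s = t")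
  case False
  then have "a (s + (t - s)) u v \<le> a s u v + a (t - s) v v"
    using assms by (intro action_triangle) auto
  moreover have "a (t - s) v v = 0"
    using assms False action_eq_0_iff[of "t - s" v v] by simp
  ultimately show ?thesis by simp
qed simp

lemma action_topology_ex1:
  "\<exists>!T. topspace T = X \<and> (\<forall>u\<in>X. neighborhoods T u = action_neighborhoods X a u)"
proof (rule ex_ex1I)
  let ?O = "\<lambda>W. W \<subseteq> X \<and> (\<forall>u\<in>W. W \<in> action_neighborhoods X a u)"
  have up: "M \<in> action_neighborhoods X a u"
    if "N \<in> action_neighborhoods X a u" "N \<subseteq> M" "M \<subseteq> X" for N M u
    using that unfolding action_neighborhoods_def by blast
  have int: "N \<inter> M \<in> action_neighborhoods X a u"
    if N: "N \<in> action_neighborhoods X a u" and M: "M \<in> action_neighborhoods X a u"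
      and u: "u \<in> X" for N M u
  proof -
    obtain s c t e where *: "0 < s" "0 < c" "{v \<in> X. a s u v < c} \<subseteq> N"
        "0 < t" "0 < e" "{v \<in> X. a t u v < e} \<subseteq> M"
      using N M unfolding action_neighborhoods_def by blast
    have "a s u v \<le> a (min s t) u v" "a t u v \<le> a (min s t) u v" if "v \<in> X" for v
      using * u that by (auto intro!: action_antimono)
    then have "{v \<in> X. a (min s t) u v < min c e} \<subseteq> N \<inter> M"
      using * by fastforce
    moreover have "0 < min s t" "0 < min c e" using * by auto
    ultimately show ?thesis
      using N unfolding action_neighborhoods_def by blast
  qed
  have top: "istopology ?O"
    unfolding istopology_def
  proof safe
    fix S T u assume "u \<in> S" "u \<in> T" "S \<subseteq> X"
      "\<forall>u\<in>S. S \<in> action_neighborhoods X a u" "\<forall>u\<in>T. T \<in> action_neighborhoods X a u"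
    then show "S \<inter> T \<in> action_neighborhoods X a u" using int by blast
  next
    fix K S u assume K: "\<forall>S\<in>K. ?O S" and S: "S \<in> K" "u \<in> S"
    then show "\<Union>K \<in> action_neighborhoods X a u"
      by - (rule up[of S], auto)
  qed auto
  have op: "openin (topology ?O) = ?O"
    using topology_inverse'[OF top] .
  have nX: "X \<in> action_neighborhoods X a u" for u
    unfolding action_neighborhoods_def by (auto intro: exI[of _ 1])
  have tX: "topspace (topology ?O) = X"
    unfolding topspace_def op using nX by auto
  have self: "u \<in> N" if "N \<in> action_neighborhoods X a u" "u \<in> X" for N u
    using that action_eq_0_iff[of _ u u] unfolding action_neighborhoods_def by auto
  have "neighborhoods (topology ?O) u = action_neighborhoods X a u" if u: "u \<in> X" for u
  proof (intro equalityI subsetI)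
    fix N assume "N \<in> neighborhoods (topology ?O) u"
    then show "N \<in> action_neighborhoods X a u"
      unfolding neighborhoods_def op tX using up by blast
  next
    fix N assume N: "N \<in> action_neighborhoods X a u"
    define W where "W = {v \<in> X. N \<in> action_neighborhoods X a v}"
    have "W \<in> action_neighborhoods X a v" if vW: "v \<in> W" for v
    proof -
      obtain t c where *: "0 < t" "0 < c" "{w \<in> X. a t v w < c} \<subseteq> N" and v: "v \<in> X"
        using vW unfolding W_def action_neighborhoods_def by blast
      have "w \<in> W" if w: "w \<in> X" "a (t / 2) v w < c / 2" for w
      proof -
        have "z \<in> N" if z: "z \<in> X" "a (t / 2) w z < c / 2" for z
          using action_triangle[of "t / 2" "t / 2" v w z] * v w z by auto
        then have "{z \<in> X. a (t / 2) w z < c / 2} \<subseteq> N" by blast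
        moreover have "0 < t / 2" "0 < c / 2" using * by auto
        ultimately show ?thesis
          using w N unfolding W_def action_neighborhoods_def by blast
      qed
      then have "{w \<in> X. a (t / 2) v w < c / 2} \<subseteq> W" by blast
      moreover have "0 < t / 2" "0 < c / 2" "W \<subseteq> X" using * by (auto simp: W_def)
      ultimately show ?thesis unfolding action_neighborhoods_def by blast
    qed
    then have "openin (topology ?O) W" unfolding op by (auto simp: W_def)
    moreover have "u \<in> W" "W \<subseteq> N" using N u self by (auto simp: W_def)
    moreover have "N \<subseteq> X" using N by (simp add: action_neighborhoods_def)
    ultimately show "N \<in> neighborhoods (topology ?O) u"
      unfolding neighborhoods_def mem_Collect_eq tX by iprover
  qed
  with tX show "\<exists>T. topspace T = X \<and> (\<forall>u\<in>X. neighborhoods T u = action_neighborhoods X a u)"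
    by (intro exI[of _ "topology ?O"] conjI ballI)
next
  fix S T
  assume S: "topspace S = X \<and> (\<forall>u\<in>X. neighborhoods S u = action_neighborhoods X a u)"
    and T: "topspace T = X \<and> (\<forall>u\<in>X. neighborhoods T u = action_neighborhoods X a u)"
  have "openin S W \<longleftrightarrow> openin T W" for W
    using S T by (auto simp: openin_iff_neighborhoods subset_iff)
  then show "S = T" by (simp add: topology_eq)
qed

lemma topspace_action_topology: "topspace (action_topology X a) = X"
  and neighborhoods_action_topology:
    "u \<in> X \<Longrightarrow> neighborhoods (action_topology X a) u = action_neighborhoods X a u"
  using theI'[OF action_topology_ex1] unfolding action_topology_def by auto

end

end

theory Submission
  imports Defs
begin

text \<open>
  Since \<open>a \<tau> v v = 0\<close>, the triangle inequality of an action makes \<open>\<tau> \<mapsto> a \<tau> u v\<close> nonincreasing,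
  whereas \<open>\<tau> \<mapsto> lam * \<tau>\<close> increases strictly. The times \<open>r > 0\<close> with \<open>a r u v < lam * r\<close>, called
  admissible for \<open>(u, v)\<close> here, therefore form a half-line that is unbounded to the right, and the
  distance is \<open>lam\<close> times its left endpoint. Below any \<open>x\<close> exceeding the distance there is thus an admissible level
  \<open>lam * s < x\<close> (\<open>action_dist_less_iff\<close>), and everything follows from comparing levels.

  For the triangle inequality, admissible times \<open>s\<close> for \<open>(u, v)\<close> and \<open>t\<close> for \<open>(v, w)\<close> add up to an
  admissible time \<open>s + t\<close> for \<open>(u, w)\<close>, because both sides of the defining inequality add up. The
  estimate by \<open>max (lam * \<tau>) (a \<tau> u v)\<close> holds because every time beyond \<open>\<tau>\<close> and \<open>a \<tau> u v / lam\<close> is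
  admissible (\<open>action_dist_le_max\<close>), and the opposite estimate because admissibility persists at
  later times (\<open>action_less_of_action_dist_less\<close>). These two estimates, read on entourages, are the
  inclusions between the two families; the uniformities agree because the families are
  cofinal in each other, and the topologies agree by taking sections of the entourages.
\<close>

section \<open>Admissible times and the estimates for the distance\<close>

context action_space
begin

lemma admissible_mono:
  assumes "0 < lam" "0 < s" "s \<le> r" "u \<in> X" "v \<in> X" "a s u v < lam * s"
  shows "a r u v < lam * r"
proof -
  have "a r u v \<le> a s u v" using assms by (intro action_antimono)
  also have "\<dots> < lam * s" by fact
  also have "\<dots> \<le> lam * r" using assms by simp
  finally show ?thesis .
qed

lemma admissible_beyond:
  assumes "0 < lam" "0 < \<tau>" "u \<in> X" "v \<in> X" "max \<tau> (a \<tau> u v / lam) < s"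
  shows "0 < s" "a s u v < lam * s"
proof -
  show "0 < s" using assms by simp
  have "a s u v \<le> a \<tau> u v" using assms by (intro action_antimono) auto
  also have "\<dots> < lam * s" using assms by (simp add: field_simps)
  finally show "a s u v < lam * s" .
qed

text \<open>The set of admissible times is nonempty, so its infimum is approximated from within. The
  equivalence replaces the infimum by a witness, which is what every estimate below needs.\<close>

lemma action_dist_less_iff:
  assumes lam: "0 < lam" and uv: "u \<in> X" "v \<in> X"
  shows "action_dist X a lam u v < x \<longleftrightarrow> (\<exists>s>0. a s u v < lam * s \<and> lam * s < x)"
proof -
  let ?S = "{r. 0 < r \<and> a r u v < lam * r}"
  have "max 1 (a 1 u v / lam) + 1 \<in> ?S"
    using admissible_beyond[OF lam _ uv, of 1 "max 1 (a 1 u v / lam) + 1"] by simp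
  then have "?S \<noteq> {}" by blast
  moreover have "bdd_below ?S" by (intro bdd_belowI[of _ 0]) auto
  ultimately have "Inf ?S < x / lam \<longleftrightarrow> (\<exists>s\<in>?S. s < x / lam)"
    by (rule cInf_less_iff)
  then show ?thesis
    using lam uv by (auto simp: action_dist_def field_simps)
qed

lemma action_less_of_action_dist_less:
  assumes "0 < lam" "u \<in> X" "v \<in> X" "action_dist X a lam u v < lam * r"
  shows "a r u v < lam * r"
proof -
  obtain s where "0 < s" "a s u v < lam * s" "lam * s < lam * r"
    using assms by (auto simp: action_dist_less_iff)
  then show ?thesis using assms admissible_mono[of lam s r u v] by simp
qed

lemma action_dist_le_max:
  assumes lam: "0 < lam" and "0 < \<tau>" and uv: "u \<in> X" "v \<in> X"
  shows "action_dist X a lam u v \<le> max (lam * \<tau>) (a \<tau> u v)"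
proof (rule dense_ge)
  fix x assume "max (lam * \<tau>) (a \<tau> u v) < x"
  then have "max \<tau> (a \<tau> u v / lam) < x / lam" using lam by (auto simp: field_simps)
  then obtain s where s: "max \<tau> (a \<tau> u v / lam) < s" "s < x / lam" using dense by blast
  have "action_dist X a lam u v < x"
    unfolding action_dist_less_iff[OF lam uv]
    using admissible_beyond[OF lam \<open>0 < \<tau>\<close> uv s(1)] s(2) lam
    by (intro exI[of _ s]) (simp add: field_simps)
  then show "action_dist X a lam u v \<le> x" by simp
qed

section \<open>The metric axioms\<close>

lemma action_dist_nonneg:
  assumes "0 < lam"
  shows "0 \<le> action_dist X a lam u v"
proof (cases "u \<in> X \<and> v \<in> X")
  case True
  have "\<not> action_dist X a lam u v < 0"
    using assms True by (auto simp: action_dist_less_iff mult_less_0_iff)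
  then show ?thesis by simp
qed (auto simp: action_dist_def)

lemma action_dist_commute: "action_dist X a lam u v = action_dist X a lam v u"
proof (cases "u \<in> X \<and> v \<in> X")
  case True
  then have "{r. 0 < r \<and> a r u v < lam * r} = {r. 0 < r \<and> a r v u < lam * r}"
    using action_commute by auto
  then show ?thesis using True by (simp add: action_dist_def)
qed (auto simp: action_dist_def)

lemma action_dist_eq_0_iff:
  assumes lam: "0 < lam" and uv: "u \<in> X" "v \<in> X"
  shows "action_dist X a lam u v = 0 \<longleftrightarrow> u = v"
proof
  assume zero: "action_dist X a lam u v = 0"
  \<comment> \<open>Every time is admissible, so the action at time \<open>1\<close> lies below the arbitrarily small levels of
    earlier times.\<close>
  have "a 1 u v \<le> 0"
  proof (rule dense_ge)
    fix x :: real assume x: "0 < x"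
    define r where "r = min 1 (x / lam)"
    have r: "0 < r" "r \<le> 1" "lam * r \<le> x"
      using x lam by (auto simp: r_def min_def field_simps)
    have "a 1 u v \<le> a r u v" using r uv by (intro action_antimono)
    also have "\<dots> < lam * r"
      using r lam uv zero by (intro action_less_of_action_dist_less) auto
    finally show "a 1 u v \<le> x" using r by simp
  qed
  then show "u = v"
    using action_nonneg[of 1 u v] action_eq_0_iff[of 1 u v] uv by simp
next
  assume "u = v"
  have "action_dist X a lam u v \<le> 0"
  proof (rule dense_ge)
    fix x :: real assume x: "0 < x"
    then have "action_dist X a lam u v \<le> max (lam * (x / lam)) (a (x / lam) u v)"
      using lam uv by (intro action_dist_le_max) auto
    also have "a (x / lam) u v = 0"
      using x lam uv \<open>u = v\<close> action_eq_0_iff[of "x / lam" u v] by simp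
    finally show "action_dist X a lam u v \<le> x" using x lam by simp
  qed
  then show "action_dist X a lam u v = 0"
    using action_dist_nonneg[OF lam, of u v] by simp
qed

lemma action_dist_triangle:
  assumes lam: "0 < lam" and X: "u \<in> X" "v \<in> X" "w \<in> X"
  shows "action_dist X a lam u w \<le> action_dist X a lam u v + action_dist X a lam v w"
proof (rule field_le_epsilon)
  fix e :: real assume e: "0 < e"
  obtain s where s: "0 < s" "a s u v < lam * s" "lam * s < action_dist X a lam u v + e / 2"
    using e lam X action_dist_less_iff[of lam u v "action_dist X a lam u v + e / 2"] by auto
  obtain t where t: "0 < t" "a t v w < lam * t" "lam * t < action_dist X a lam v w + e / 2"
    using e lam X action_dist_less_iff[of lam v w "action_dist X a lam v w + e / 2"] by auto
  have "a (s + t) u w \<le> a s u v + a t v w" using s t X by (intro action_triangle)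
  also have "\<dots> < lam * (s + t)" using s t by (simp add: distrib_left)
  finally have st: "a (s + t) u w < lam * (s + t)" .
  have "action_dist X a lam u w < action_dist X a lam u v + action_dist X a lam v w + e"
    unfolding action_dist_less_iff[OF lam X(1,3)]
    using s t st by (intro exI[of _ "s + t"]) (auto simp: distrib_left)
  then show "action_dist X a lam u w \<le> action_dist X a lam u v + action_dist X a lam v w + e"
    by simp
qed

lemma Metric_space_action_dist:
  assumes "0 < lam"
  shows "Metric_space X (action_dist X a lam)"
  using assms
  by unfold_locales
    (simp_all add: action_dist_nonneg action_dist_commute action_dist_eq_0_iff action_dist_triangle)

section \<open>Inclusions between entourages\<close>

lemma action_dist_entourage_subset:
  assumes lam: "0 < lam" and r: "0 < r" "r \<le> \<tau>" "r \<le> c / lam"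
  shows "action_dist_entourage X a lam r \<subseteq> action_entourage X a \<tau> c"
proof -
  have "a \<tau> u v < c" if "u \<in> X" "v \<in> X" "action_dist X a lam u v < lam * r" for u v
  proof -
    have "a \<tau> u v \<le> a r u v" using r that by (intro action_antimono)
    also have "\<dots> < lam * r" using lam that by (rule action_less_of_action_dist_less)
    also have "\<dots> \<le> c" using lam r by (simp add: field_simps)
    finally show ?thesis .
  qed
  then show ?thesis by (auto simp: action_dist_entourage_def action_entourage_def)
qed

lemma action_entourage_subset:
  assumes "0 < lam" "0 < \<tau>" "\<tau> < r" "c \<le> lam * r"
  shows "action_entourage X a \<tau> c \<subseteq> action_dist_entourage X a lam r"
proof -
  have "action_dist X a lam u v < lam * r" if "u \<in> X" "v \<in> X" "a \<tau> u v < c" for u v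
  proof -
    have "action_dist X a lam u v \<le> max (lam * \<tau>) (a \<tau> u v)"
      using assms that by (intro action_dist_le_max)
    also have "\<dots> < lam * r" using assms that by simp
    finally show ?thesis .
  qed
  then show ?thesis by (auto simp: action_dist_entourage_def action_entourage_def)
qed

section \<open>Comparison of the uniformities and topologies\<close>

text \<open>Cofinality of the two families of entourages, with the scale \<open>\<epsilon> = lam * r\<close> in place of \<open>r\<close>.
  It is the common source of the equality of the uniformities and of the topologies.\<close>

lemma metric_entourage_within_action_entourage:
  assumes "0 < lam" "0 < \<tau>" "0 < c"
  obtains \<epsilon> where "0 < \<epsilon>"
    "{(u, v) \<in> X \<times> X. action_dist X a lam u v < \<epsilon>} \<subseteq> action_entourage X a \<tau> c"
proof
  show "0 < lam * min \<tau> (c / lam)" using assms by simp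
  show "{(u, v) \<in> X \<times> X. action_dist X a lam u v < lam * min \<tau> (c / lam)}
      \<subseteq> action_entourage X a \<tau> c"
    using action_dist_entourage_subset[of lam "min \<tau> (c / lam)" \<tau> c] assms
    by (simp add: action_dist_entourage_def)
qed

lemma action_entourage_within_metric_entourage:
  assumes "0 < lam" "0 < \<epsilon>"
  obtains \<tau> c where "0 < \<tau>" "0 < c"
    "action_entourage X a \<tau> c \<subseteq> {(u, v) \<in> X \<times> X. action_dist X a lam u v < \<epsilon>}"
proof
  show "0 < \<epsilon> / (2 * lam)" "0 < \<epsilon>" using assms by simp_all
  show "action_entourage X a (\<epsilon> / (2 * lam)) \<epsilon>
      \<subseteq> {(u, v) \<in> X \<times> X. action_dist X a lam u v < \<epsilon>}"
    using action_entourage_subset[of lam "\<epsilon> / (2 * lam)" "\<epsilon> / lam" \<epsilon>] assms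
    by (simp add: action_dist_entourage_def field_simps)
qed

lemma metric_uniformity_action_dist:
  assumes "0 < lam"
  shows "metric_uniformity X (action_dist X a lam) = action_uniformity X a"
proof (intro equalityI subsetI)
  fix U assume "U \<in> metric_uniformity X (action_dist X a lam)"
  then obtain \<epsilon> where U: "U \<subseteq> X \<times> X" "0 < \<epsilon>"
      "{(u, v) \<in> X \<times> X. action_dist X a lam u v < \<epsilon>} \<subseteq> U"
    unfolding metric_uniformity_def by blast
  obtain \<tau> c where "0 < \<tau>" "0 < c"
      "action_entourage X a \<tau> c \<subseteq> {(u, v) \<in> X \<times> X. action_dist X a lam u v < \<epsilon>}"
    using action_entourage_within_metric_entourage[OF assms \<open>0 < \<epsilon>\<close>] .
  with U show "U \<in> action_uniformity X a" unfolding action_uniformity_def by blast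
next
  fix U assume "U \<in> action_uniformity X a"
  then obtain \<tau> c where U: "U \<subseteq> X \<times> X" "0 < \<tau>" "0 < c" "action_entourage X a \<tau> c \<subseteq> U"
    unfolding action_uniformity_def by blast
  obtain \<epsilon> where "0 < \<epsilon>"
      "{(u, v) \<in> X \<times> X. action_dist X a lam u v < \<epsilon>} \<subseteq> action_entourage X a \<tau> c"
    using metric_entourage_within_action_entourage[OF assms \<open>0 < \<tau>\<close> \<open>0 < c\<close>] .
  with U show "U \<in> metric_uniformity X (action_dist X a lam)"
    unfolding metric_uniformity_def by blast
qed

lemma mtopology_action_dist:
  assumes lam: "0 < lam"
  shows "Metric_space.mtopology X (action_dist X a lam) = action_topology X a"
proof -
  interpret M: Metric_space X "action_dist X a lam"
    using lam by (rule Metric_space_action_dist)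
  \<comment> \<open>Balls are the sections at \<open>u\<close> of entourages, so the cofinality of entourages passes to them.\<close>
  have ball_iff: "(\<exists>\<epsilon>>0. M.mball u \<epsilon> \<subseteq> W) \<longleftrightarrow> W \<in> action_neighborhoods X a u"
    if "u \<in> X" "W \<subseteq> X" for u W
  proof
    assume "\<exists>\<epsilon>>0. M.mball u \<epsilon> \<subseteq> W"
    then obtain \<epsilon> where \<epsilon>: "0 < \<epsilon>" "M.mball u \<epsilon> \<subseteq> W" by blast
    obtain \<tau> c where \<tau>: "0 < \<tau>" "0 < c"
        "action_entourage X a \<tau> c \<subseteq> {(u, v) \<in> X \<times> X. action_dist X a lam u v < \<epsilon>}"
      using action_entourage_within_metric_entourage[OF lam \<open>0 < \<epsilon>\<close>] .
    have "{v \<in> X. a \<tau> u v < c} \<subseteq> M.mball u \<epsilon>"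
      using \<tau>(3) that by (auto simp: action_entourage_def)
    with \<epsilon> \<tau> that show "W \<in> action_neighborhoods X a u"
      unfolding action_neighborhoods_def by blast
  next
    assume "W \<in> action_neighborhoods X a u"
    then obtain \<tau> c where \<tau>: "0 < \<tau>" "0 < c" "{v \<in> X. a \<tau> u v < c} \<subseteq> W"
      unfolding action_neighborhoods_def by blast
    obtain \<epsilon> where \<epsilon>: "0 < \<epsilon>"
        "{(u, v) \<in> X \<times> X. action_dist X a lam u v < \<epsilon>} \<subseteq> action_entourage X a \<tau> c"
      using metric_entourage_within_action_entourage[OF lam \<open>0 < \<tau>\<close> \<open>0 < c\<close>] .
    have "M.mball u \<epsilon> \<subseteq> {v \<in> X. a \<tau> u v < c}"
      using subsetD[OF \<epsilon>(2)] by (auto simp: action_entourage_def)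
    with \<epsilon> \<tau> show "\<exists>\<epsilon>>0. M.mball u \<epsilon> \<subseteq> W" by blast
  qed
  have "openin M.mtopology W \<longleftrightarrow> openin (action_topology X a) W" for W
  proof -
    have "openin M.mtopology W \<longleftrightarrow> W \<subseteq> X \<and> (\<forall>u\<in>W. W \<in> action_neighborhoods X a u)"
      unfolding M.openin_mtopology using ball_iff by blast
    also have "\<dots> \<longleftrightarrow> openin (action_topology X a) W"
      using neighborhoods_action_topology
      by (auto simp: openin_iff_neighborhoods topspace_action_topology)
    finally show ?thesis .
  qed
  then show ?thesis by (simp add: topology_eq)
qed

end

section \<open>Metrization of an action space\<close>

theorem theorem4p5:
  fixes X :: "'a set" and a :: "real \<Rightarrow> 'a \<Rightarrow> 'a \<Rightarrow> real" and lam :: real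
  assumes "action_space X a" and "0 < lam"
  shows "Metric_space X (action_dist X a lam) \<and>
    (\<forall>\<tau>>0. \<forall>u\<^sub>1\<in>X. \<forall>u\<^sub>2\<in>X.
       action_dist X a lam u\<^sub>1 u\<^sub>2 \<le> max (lam * \<tau>) (a \<tau> u\<^sub>1 u\<^sub>2) \<and>
       max (lam * \<tau>) (a \<tau> u\<^sub>1 u\<^sub>2) \<le> lam * \<tau> + a \<tau> u\<^sub>1 u\<^sub>2) \<and>
    (\<forall>r>0. \<forall>u\<^sub>1\<in>X. \<forall>u\<^sub>2\<in>X.
       action_dist X a lam u\<^sub>1 u\<^sub>2 < lam * r \<longrightarrow> a r u\<^sub>1 u\<^sub>2 < lam * r) \<and>
    metric_uniformity X (action_dist X a lam) = action_uniformity X a \<and>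
    Metric_space.mtopology X (action_dist X a lam) = action_topology X a \<and>
    (\<forall>\<tau>>0. \<forall>c>0. \<forall>r\<in>{0<..min \<tau> (c / lam)}.
       action_dist_entourage X a lam r \<subseteq> action_entourage X a \<tau> c) \<and>
    (\<forall>r>0. \<forall>\<tau>\<in>{0<..<r}. \<forall>c\<in>{0<..lam * r}.
       action_entourage X a \<tau> c \<subseteq> action_dist_entourage X a lam r)"
proof -
  interpret action_space X a by fact
  note lam = \<open>0 < lam\<close>
  have max_le_add: "max (lam * \<tau>) (a \<tau> u v) \<le> lam * \<tau> + a \<tau> u v"
    if "0 < \<tau>" "u \<in> X" "v \<in> X" for \<tau> u v
    using that lam action_nonneg[of \<tau> u v] by simp
  show ?thesis
    using Metric_space_action_dist[OF lam] action_dist_le_max[OF lam] max_le_add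
      action_less_of_action_dist_less[OF lam] metric_uniformity_action_dist[OF lam]
      mtopology_action_dist[OF lam] action_dist_entourage_subset[OF lam]
      action_entourage_subset[OF lam]
    by (intro conjI) simp_all
qed

end
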